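(* (Correctness of the Knuth-like polarity-balanced construction.) Let $q\ge 2$ and $k\ge 1$ be integers, with $k$ even if $q$ is even, and let ${\bf u}\in({\cal A}_q)^k$. (i) If $q$ is odd, there exists a symbol $a\in{\cal A}_q$ such that the number $S_a({\bf u})$ of occurrences of $a$ in ${\bf u}$ has the same parity as $k$. (ii) Let ${\bf u}'={\bf u}$ if $q$ is even, and let ${\bf u}'={\bf u}\oplus_{2q}(-a,-a,\ldots,-a)$ with $a$ any symbol as in (i) if $q$ is odd. Then there exists $z\in\{0,1,\ldots,k-1\}$ such that the sequence ${\bf x}$ obtained from ${\bf u}'$ by multiplying its first $z$ symbols by $-1$ is polarity-balanced. (iii) Consequently, let $\pi$ be any injective map from $\{0,\ldots,k-1\}$ (if $q$ is even), respectively from ${\cal A}_q\times\{0,\ldots,k-1\}$ (if $q$ is odd), into the set of polarity-balanced sequences of some length $p$ over ${\cal A}_q$. If $q$ is odd, choose $a\in{\cal A}_q$ such that $S_a({\bf u})$ has the same parity as $k$ and put ${\bf u}'={\bf u}\oplus_{2q}(-a,-a,\ldots,-a)$; if $q$ is even, put ${\bf u}'={\bf u}$. Choose $z\in\{0,1,\ldots,k-1\}$ such that the sequence ${\bf x}$ obtained from ${\bf u}'$ by multiplying its first $z$ symbols by $-1$ is polarity-balanced. Encode ${\bf u}$ as ${\bf c}=({\bf p},{\bf x})$ with ${\bf p}=\pi(z)$ (if $q$ is even) or ${\bf p}=\pi(a,z)$ (if $q$ is odd). Then ${\bf c}$ is polarity-balanced, and ${\bf u}$ is recovered from ${\bf c}$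 by retrieving $z$ (and $a$ if $q$ is odd) from ${\bf p}$, multiplying the first $z$ symbols of ${\bf x}$ by $-1$, and, if $q$ is odd, then adding $(a,a,\ldots,a)$ with $\oplus_{2q}$.
   Context: For an integer $q\ge 2$, ${\cal A}_q=\{-q+1,-q+3,\ldots,q-3,q-1\}$. A sequence over ${\cal A}_q$ is polarity-balanced (PB) if its number of positive symbols equals its number of negative symbols. $S_j({\bf y})=|\{i:y_i=j\}|$ is the number of occurrences of the symbol $j$ in ${\bf y}$. $\oplus_{2q}$ denotes (componentwise) integer addition followed by reduction modulo $2q$ such that the outcome lies in ${\cal A}_q$; it is used here only for $q$ odd, when all symbols of ${\cal A}_q$ are even. $({\bf p},{\bf x})$ denotes concatenation. *)

theory Defs
  imports "HOL-Number_Theory.Cong"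
begin

definition alphabet :: "nat \<Rightarrow> int set" where
  "alphabet q = {- int q + 1 + 2 * int i | i. i < q}"

definition seqs :: "nat \<Rightarrow> nat \<Rightarrow> int list set" where
  "seqs q n = {xs. length xs = n \<and> set xs \<subseteq> alphabet q}"

definition polarity_balanced :: "int list \<Rightarrow> bool" where
  "polarity_balanced xs \<longleftrightarrow>
     length (filter (\<lambda>x. x > 0) xs) = length (filter (\<lambda>x. x < 0) xs)"

definition pb_seqs :: "nat \<Rightarrow> nat \<Rightarrow> int list set" where
  "pb_seqs q n = {xs \<in> seqs q n. polarity_balanced xs}"

(* Only meaningful for q odd: then all symbols are even and every even integer is
   congruent modulo 2q to exactly one symbol.  For q even the sum of two symbols is
   even while all symbols are odd, so no representative exists. *)
definition oplus_sym :: "nat \<Rightarrow> int \<Rightarrow> int \<Rightarrow> int" where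
  "oplus_sym q x y = (THE r. r \<in> alphabet q \<and> [r = x + y] (mod (2 * int q)))"

definition oplus :: "nat \<Rightarrow> int list \<Rightarrow> int list \<Rightarrow> int list" where
  "oplus q xs ys = map2 (oplus_sym q) xs ys"

definition flip_prefix :: "nat \<Rightarrow> int list \<Rightarrow> int list" where
  "flip_prefix z xs = map uminus (take z xs) @ drop z xs"

(* The decoders see only the codeword c and the code parameters; p is the prefix length.
   The index is retrieved by inverting the prefix map on its domain. *)
definition decode_even :: "nat \<Rightarrow> nat \<Rightarrow> (nat \<Rightarrow> int list) \<Rightarrow> int list \<Rightarrow> int list" where
  "decode_even k p \<pi> c =
     (let z = inv_into {0..<k} \<pi> (take p c)
      in flip_prefix z (drop p c))"

definition decode_odd ::
  "nat \<Rightarrow> nat \<Rightarrow> nat \<Rightarrow> (int \<times> nat \<Rightarrow> int list) \<Rightarrow> int list \<Rightarrow> int list" where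
  "decode_odd q k p \<pi> c =
     (let (a, z) = inv_into (alphabet q \<times> {0..<k}) \<pi> (take p c)
      in oplus q (flip_prefix z (drop p c)) (replicate k a))"

end

theory Submission
  imports Defs
begin

text \<open>
  Flipping the first \<open>z\<close> symbols subtracts twice the sign sum \<open>h z\<close> of that prefix from the total
  sign sum \<open>s\<close>.  As \<open>h\<close> moves in steps of size at most one from \<open>0\<close> to \<open>s\<close>, it attains \<open>s / 2\<close> whenever
  \<open>s\<close> is even, i.e. whenever the number of nonzero symbols is even.  For \<open>q\<close> odd the shift by
  \<open>-a\<close> turns exactly the occurrences of \<open>a\<close> into zeros, and a suitable \<open>a\<close> exists because an odd
  number of counts, all of parity opposite to \<open>k\<close>, cannot add up to \<open>k\<close>.
\<close>

section \<open>The alphabet and the parity of symbol counts\<close>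

text \<open>Trading the index \<open>i\<close> for a bound and a parity condition reduces later
  facts about symbols to linear arithmetic and parity.\<close>

lemma mem_alphabet_iff: "x \<in> alphabet q \<longleftrightarrow> \<bar>x\<bar> < int q \<and> even (x + int q + 1)"
proof
  assume "\<bar>x\<bar> < int q \<and> even (x + int q + 1)"
  then have e: "even (x + int q - 1)" and b: "\<bar>x\<bar> < int q" by auto
  from e obtain m where "x + int q - 1 = 2 * m" by (elim evenE)
  with b have "x = - int q + 1 + 2 * int (nat m)" "nat m < q" by auto
  then show "x \<in> alphabet q" unfolding alphabet_def by blast
qed (auto simp: alphabet_def)

lemma finite_alphabet: "finite (alphabet q)"
  by (rule finite_subset[of _ "{- int q .. int q}"]) (auto simp: mem_alphabet_iff)

lemma card_alphabet: "card (alphabet q) = q"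
proof -
  have "alphabet q = (\<lambda>i. - int q + 1 + 2 * int i) ` {..<q}"
    by (auto simp: alphabet_def)
  moreover have "inj_on (\<lambda>i. - int q + 1 + 2 * int i) {..<q}" by (auto simp: inj_on_def)
  ultimately show ?thesis by (simp add: card_image)
qed

lemma uminus_mem_alphabet: "- x \<in> alphabet q \<longleftrightarrow> x \<in> alphabet q"
  by (auto simp: mem_alphabet_iff)

lemma sum_count_list_eq_length:
  assumes "finite A" and "set xs \<subseteq> A"
  shows "(\<Sum>a\<in>A. count_list xs a) = length xs"
proof -
  have "(\<Sum>a\<in>A. count_list xs a) = (\<Sum>a\<in>set xs. count_list xs a)"
    using assms by (intro sum.mono_neutral_right) auto
  then show ?thesis by (simp add: sum_count_set)
qed

lemma exists_symbol_count_parity: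
  assumes "odd q" and "u \<in> seqs q k"
  shows "\<exists>a\<in>alphabet q. even (count_list u a) \<longleftrightarrow> even k"
proof (rule ccontr)
  assume "\<not> ?thesis"
  then have *: "even (count_list u a) \<longleftrightarrow> odd k" if "a \<in> alphabet q" for a
    using that by blast
  have "(\<Sum>a\<in>alphabet q. count_list u a) = k"
    using assms(2) sum_count_list_eq_length[OF finite_alphabet] by (auto simp: seqs_def)
  moreover have "even (\<Sum>a\<in>alphabet q. count_list u a) \<longleftrightarrow>
      even (card {a \<in> alphabet q. odd (count_list u a)})"
    by (simp add: even_sum_iff finite_alphabet)
  \<comment> \<open>Under the negated claim every count is odd if \<open>k\<close> is even, and none
    is if \<open>k\<close> is odd. As the alphabet has \<open>q\<close> elements and
    \<open>q\<close> is odd, the total \<open>k\<close> gets the wrong parity either way.\<close>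
  moreover have "{a \<in> alphabet q. odd (count_list u a)} = (if even k then alphabet q else {})"
    using * by auto
  ultimately show False using assms(1) card_alphabet by (auto split: if_splits)
qed

section \<open>Sign sums and prefix flips\<close>

lemma polarity_balanced_iff_sum_sgn: "polarity_balanced xs \<longleftrightarrow> sum_list (map sgn xs) = 0"
proof -
  have "sum_list (map sgn xs) =
      int (length (filter (\<lambda>x. x > 0) xs)) - int (length (filter (\<lambda>x. x < 0) xs))"
    by (induction xs) (auto simp: sgn_if)
  then show ?thesis by (auto simp: polarity_balanced_def)
qed

lemma polarity_balanced_append:
  "polarity_balanced xs \<Longrightarrow> polarity_balanced ys \<Longrightarrow> polarity_balanced (xs @ ys)"
  by (simp add: polarity_balanced_def)

text \<open>A nonzero symbol contributes an odd sign and a zero an even one, so the sign sum has the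
  parity of the number of nonzero symbols; the sum on the right has the same parity and avoids
  subtraction on \<open>nat\<close>.\<close>

lemma even_sum_sgn_iff:
  fixes xs :: "int list"
  shows "even (sum_list (map sgn xs)) \<longleftrightarrow> even (length xs + count_list xs 0)"
  by (induction xs) (auto simp: sgn_if)

lemma sum_sgn_flip_prefix:
  "sum_list (map sgn (flip_prefix z xs)) =
     sum_list (map sgn xs) - 2 * sum_list (map sgn (take z xs))"
proof -
  have "sum_list (map sgn (map uminus ys)) = - sum_list (map sgn ys)" for ys :: "int list"
    by (induction ys) auto
  moreover have "sum_list (map sgn xs) =
      sum_list (map sgn (take z xs)) + sum_list (map sgn (drop z xs))"
    by (metis append_take_drop_id map_append sum_list_append)
  ultimately show ?thesis by (simp add: flip_prefix_def del: map_map)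
qed

lemma length_flip_prefix [simp]: "length (flip_prefix z xs) = length xs"
  by (simp add: flip_prefix_def)

lemma flip_prefix_flip_prefix [simp]: "flip_prefix z (flip_prefix z xs) = xs"
proof (cases "z \<le> length xs")
  case True
  then show ?thesis by (simp add: flip_prefix_def comp_def)
qed (simp add: flip_prefix_def comp_def)

lemma flip_prefix_mem_seqs:
  assumes "xs \<in> seqs q k"
  shows "flip_prefix z xs \<in> seqs q k"
proof -
  have "set xs = set (take z xs) \<union> set (drop z xs)"
    by (metis append_take_drop_id set_append)
  with assms show ?thesis
    by (auto simp: seqs_def flip_prefix_def uminus_mem_alphabet)
qed

lemma exists_half_prefix_sum_sgn:
  fixes xs :: "int list"
  assumes "even (sum_list (map sgn xs))"
  shows "\<exists>z\<le>length xs. 2 * sum_list (map sgn (take z xs)) = sum_list (map sgn xs)"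
proof -
  define s where "s = sum_list (map sgn xs)"
  define h where "h z = sum_list (map sgn (take z xs))" for z
  have ends: "h 0 = 0" "h (length xs) = s" by (simp_all add: h_def s_def)
  have step: "\<bar>h (Suc i) - h i\<bar> \<le> 1" if "i < length xs" for i
    using that by (simp add: h_def take_Suc_conv_app_nth sgn_if)
  obtain m where m: "s = 2 * m" using assms by (auto simp: s_def elim: evenE)
  have "\<exists>z\<le>length xs. h z = m"
  proof (cases "0 \<le> s")
    case True
    then show ?thesis
      using nat0_intermed_int_val[of "length xs" h m] step ends m by auto
  next
    case False
    \<comment> \<open>The intermediate value theorem expects the target to lie between a lower start
      and a higher end, so for negative \<open>s\<close> it is applied to
      \<open>- h\<close>.\<close>
    have "\<exists>z\<le>length xs. - h z = - m"
      by (rule nat0_intermed_int_val) (use False step ends m in \<open>auto simp: abs_minus_commute\<close>)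
    then show ?thesis by auto
  qed
  then show ?thesis using m by (auto simp: h_def s_def)
qed

lemma exists_balancing_flip:
  assumes "xs \<in> seqs q k" and "k \<ge> 1" and "even (k + count_list xs 0)"
  shows "\<exists>z\<in>{0..<k}. flip_prefix z xs \<in> pb_seqs q k"
proof -
  have len: "length xs = k" using assms(1) by (simp add: seqs_def)
  have "even (sum_list (map sgn xs))" using assms(3) len by (simp add: even_sum_sgn_iff)
  then obtain z where z: "z \<le> k" "2 * sum_list (map sgn (take z xs)) = sum_list (map sgn xs)"
    using exists_half_prefix_sum_sgn len by blast
  \<comment> \<open>The bound must become strict: a half sum reached at \<open>z = k\<close> forces
    the total to be 0, and then \<open>z = 0\<close> serves as well, which is below \<open>k\<close>
    because \<open>k \<ge> 1\<close>.\<close>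
  have "\<exists>z<k. 2 * sum_list (map sgn (take z xs)) = sum_list (map sgn xs)"
  proof (cases "z = k")
    case True
    with z len have "sum_list (map sgn xs) = 0" by simp
    then show ?thesis using assms(2) by (intro exI[of _ 0]) auto
  next
    case False
    with z show ?thesis by (intro exI[of _ z]) simp
  qed
  then obtain z where "z < k" "2 * sum_list (map sgn (take z xs)) = sum_list (map sgn xs)"
    by blast
  then show ?thesis
    using flip_prefix_mem_seqs[OF assms(1)]
    by (intro bexI[of _ z])
      (simp_all add: pb_seqs_def polarity_balanced_iff_sum_sgn sum_sgn_flip_prefix)
qed

section \<open>Addition modulo \<open>2 * q\<close> on the alphabet\<close>

text \<open>Two symbols differ by less than the modulus. This gives the uniqueness behind the
  definite description in \<open>oplus_sym\<close>.\<close>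

lemma alphabet_cong_imp_eq:
  assumes "x \<in> alphabet q" and "y \<in> alphabet q" and "[x = y] (mod (2 * int q))"
  shows "x = y"
proof -
  have "2 * int q dvd x - y" using assms(3) by (simp add: cong_iff_dvd_diff)
  moreover have "\<bar>x - y\<bar> < 2 * int q" using assms(1,2) by (auto simp: mem_alphabet_iff)
  ultimately show ?thesis using dvd_imp_le_int[of "x - y" "2 * int q"] by force
qed

lemma oplus_sym_eqI:
  assumes "r \<in> alphabet q" and "[r = x + y] (mod (2 * int q))"
  shows "oplus_sym q x y = r"
  unfolding oplus_sym_def
proof (rule the_equality)
  show "r' = r" if "r' \<in> alphabet q \<and> [r' = x + y] (mod (2 * int q))" for r'
    using that assms by (intro alphabet_cong_imp_eq) (auto intro: cong_trans cong_sym)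
qed (use assms in simp)

lemma exists_alphabet_cong:
  assumes "odd q" and "even w"
  shows "\<exists>r\<in>alphabet q. [r = w] (mod (2 * int q))"
proof -
  \<comment> \<open>Adding \<open>q - 1\<close> carries the alphabet to the even numbers from 0 to
    \<open>2 * q - 2\<close>, so the representative comes from ordinary reduction followed by the
    shift back.\<close>
  define t where "t = (w + int q - 1) mod (2 * int q)"
  have q: "0 < int q" using assms(1) by (auto elim: oddE)
  have t: "even t" using assms by (simp add: t_def dvd_mod_iff)
  have "0 \<le> t" "t < 2 * int q" using q by (simp_all add: t_def)
  \<comment> \<open>This odd residue would be shifted back to \<open>q\<close>, just outside the
    alphabet.\<close>
  moreover have "t \<noteq> 2 * int q - 1" using t by presburger
  ultimately have "\<bar>t - (int q - 1)\<bar> < int q" by linarith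
  with t have "t - (int q - 1) \<in> alphabet q" by (simp add: mem_alphabet_iff)
  moreover have "[t - (int q - 1) = (w + int q - 1) - (int q - 1)] (mod (2 * int q))"
    by (intro cong_diff) (simp_all add: t_def cong_def)
  ultimately show ?thesis by (intro bexI[of _ "t - (int q - 1)"]) simp_all
qed

lemma
  assumes "odd q" and "x \<in> alphabet q" and "y \<in> alphabet q"
  shows oplus_sym_mem_alphabet: "oplus_sym q x y \<in> alphabet q"
    and oplus_sym_cong: "[oplus_sym q x y = x + y] (mod (2 * int q))"
proof -
  have "even (x + y)" using assms by (auto simp: mem_alphabet_iff)
  then obtain r where "r \<in> alphabet q" "[r = x + y] (mod (2 * int q))"
    using exists_alphabet_cong assms(1) by blast
  moreover from this have "oplus_sym q x y = r" by (rule oplus_sym_eqI)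
  ultimately show "oplus_sym q x y \<in> alphabet q" "[oplus_sym q x y = x + y] (mod (2 * int q))"
    by simp_all
qed

lemma oplus_sym_uminus_cancel:
  assumes "odd q" and "x \<in> alphabet q" and "a \<in> alphabet q"
  shows "oplus_sym q (oplus_sym q x (- a)) a = x"
proof (rule oplus_sym_eqI)
  have "[oplus_sym q x (- a) + a = x + - a + a] (mod (2 * int q))"
    using assms by (intro cong_add oplus_sym_cong) (auto simp: uminus_mem_alphabet)
  then show "[x = oplus_sym q x (- a) + a] (mod (2 * int q))" by (simp add: cong_sym)
qed (fact assms(2))

text \<open>If the shift yields 0, adding \<open>a\<close> back gives \<open>x\<close> by
  cancellation and \<open>a\<close> by direct evaluation.\<close>

lemma oplus_sym_uminus_eq_0_iff:
  assumes "odd q" and "x \<in> alphabet q" and "a \<in> alphabet q"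
  shows "oplus_sym q x (- a) = 0 \<longleftrightarrow> x = a"
proof
  assume "oplus_sym q x (- a) = 0"
  then have "oplus_sym q 0 a = x" using oplus_sym_uminus_cancel[OF assms] by simp
  moreover have "oplus_sym q 0 a = a" using assms(3) by (intro oplus_sym_eqI) auto
  ultimately show "x = a" by simp
next
  assume "x = a"
  moreover have "0 \<in> alphabet q" using assms(1) by (auto simp: mem_alphabet_iff elim: oddE)
  ultimately show "oplus_sym q x (- a) = 0" by (intro oplus_sym_eqI) auto
qed

lemma oplus_replicate: "length xs = k \<Longrightarrow> oplus q xs (replicate k b) = map (\<lambda>x. oplus_sym q x b) xs"
  unfolding oplus_def by (induction xs arbitrary: k) auto

lemma oplus_replicate_mem_seqs:
  assumes "odd q" and "xs \<in> seqs q k" and "b \<in> alphabet q"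
  shows "oplus q xs (replicate k b) \<in> seqs q k"
  using assms by (auto simp: seqs_def oplus_replicate intro!: oplus_sym_mem_alphabet)

lemma oplus_replicate_uminus_cancel:
  assumes "odd q" and "xs \<in> seqs q k" and "a \<in> alphabet q"
  shows "oplus q (oplus q xs (replicate k (- a))) (replicate k a) = xs"
  using assms by (auto simp: seqs_def oplus_replicate oplus_sym_uminus_cancel intro!: map_idI)

text \<open>Turns the parity condition on the occurrences of \<open>a\<close> into the condition on
  zeros in \<open>exists_balancing_flip\<close>.\<close>

lemma count_list_oplus_replicate_uminus:
  assumes "odd q" and "xs \<in> seqs q k" and "a \<in> alphabet q"
  shows "count_list (oplus q xs (replicate k (- a))) 0 = count_list xs a"
proof -
  have "set xs \<subseteq> alphabet q \<Longrightarrow> count_list (map (\<lambda>x. oplus_sym q x (- a)) xs) 0 = count_list xs a"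
    using assms(1,3) by (induction xs) (auto simp: oplus_sym_uminus_eq_0_iff)
  then show ?thesis using assms(2) by (simp add: seqs_def oplus_replicate)
qed

section \<open>Codewords and decoding\<close>

lemma append_mem_pb_seqs:
  "xs \<in> pb_seqs q m \<Longrightarrow> ys \<in> pb_seqs q n \<Longrightarrow> xs @ ys \<in> pb_seqs q (m + n)"
  by (auto simp: pb_seqs_def seqs_def polarity_balanced_append)

text \<open>The prefix length \<open>p\<close> makes \<open>take\<close> and \<open>drop\<close>
  split the codeword at the right place, and injectivity makes \<open>inv_into\<close> return the
  encoded \<open>z\<close>.\<close>

lemma decode_even_append:
  assumes "inj_on \<pi> {0..<k}" and "z \<in> {0..<k}" and "length (\<pi> z) = p"
  shows "decode_even k p \<pi> (\<pi> z @ x) = flip_prefix z x"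
  using assms by (simp add: decode_even_def inv_into_f_f)

lemma decode_odd_append:
  assumes "inj_on \<pi> (alphabet q \<times> {0..<k})" and "(a, z) \<in> alphabet q \<times> {0..<k}"
    and "length (\<pi> (a, z)) = p"
  shows "decode_odd q k p \<pi> (\<pi> (a, z) @ x) = oplus q (flip_prefix z x) (replicate k a)"
  using assms(3) inv_into_f_f[OF assms(1,2)] by (simp add: decode_odd_def)

theorem mainTheorem9:
  fixes q k :: nat and u :: "int list"
  assumes "q \<ge> 2" and "k \<ge> 1" and "even q \<Longrightarrow> even k" and "u \<in> seqs q k"
  shows
    "(odd q \<longrightarrow> (\<exists>a\<in>alphabet q. even (count_list u a) \<longleftrightarrow> even k))
   \<and> (even q \<longrightarrow> (\<exists>z\<in>{0..<k}. flip_prefix z u \<in> pb_seqs q k))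
   \<and> (odd q \<longrightarrow>
        (\<forall>a\<in>alphabet q. (even (count_list u a) \<longleftrightarrow> even k) \<longrightarrow>
          (\<exists>z\<in>{0..<k}. flip_prefix z (oplus q u (replicate k (- a))) \<in> pb_seqs q k)))
   \<and> (even q \<longrightarrow>
        (\<forall>(p::nat) (\<pi> :: nat \<Rightarrow> int list) z x c.
          inj_on \<pi> {0..<k} \<longrightarrow> \<pi> ` {0..<k} \<subseteq> pb_seqs q p \<longrightarrow>
          z \<in> {0..<k} \<longrightarrow> x = flip_prefix z u \<longrightarrow> polarity_balanced x \<longrightarrow>
          c = \<pi> z @ x \<longrightarrow>
          c \<in> pb_seqs q (p + k) \<and> decode_even k p \<pi> c = u))
   \<and> (odd q \<longrightarrow>
        (\<forall>(p::nat) (\<pi> :: int \<times> nat \<Rightarrow> int list) a z x c.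
          inj_on \<pi> (alphabet q \<times> {0..<k}) \<longrightarrow>
          \<pi> ` (alphabet q \<times> {0..<k}) \<subseteq> pb_seqs q p \<longrightarrow>
          a \<in> alphabet q \<longrightarrow> (even (count_list u a) \<longleftrightarrow> even k) \<longrightarrow>
          z \<in> {0..<k} \<longrightarrow>
          x = flip_prefix z (oplus q u (replicate k (- a))) \<longrightarrow> polarity_balanced x \<longrightarrow>
          c = \<pi> (a, z) @ x \<longrightarrow>
          c \<in> pb_seqs q (p + k) \<and> decode_odd q k p \<pi> c = u))"
proof (intro conjI impI allI ballI)
  assume "odd q"
  then show "\<exists>a\<in>alphabet q. even (count_list u a) \<longleftrightarrow> even k"
    using exists_symbol_count_parity assms(4) by blast
next
  assume "even q"
  \<comment> \<open>For \<open>q\<close> even all symbols are odd, so \<open>u\<close> has no zeros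
    and the evenness of \<open>k\<close> is the parity condition.\<close>
  then have "0 \<notin> alphabet q" by (simp add: mem_alphabet_iff)
  then have "count_list u 0 = 0"
    using assms(4) by (auto simp: seqs_def count_list_0_iff)
  then show "\<exists>z\<in>{0..<k}. flip_prefix z u \<in> pb_seqs q k"
    using exists_balancing_flip assms \<open>even q\<close> by simp
next
  fix a
  assume a: "odd q" "a \<in> alphabet q" "even (count_list u a) \<longleftrightarrow> even k"
  show "\<exists>z\<in>{0..<k}. flip_prefix z (oplus q u (replicate k (- a))) \<in> pb_seqs q k"
  proof (rule exists_balancing_flip)
    show "oplus q u (replicate k (- a)) \<in> seqs q k"
      using a assms(4) by (simp add: oplus_replicate_mem_seqs uminus_mem_alphabet)
    show "even (k + count_list (oplus q u (replicate k (- a))) 0)"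
      using a assms(4) by (simp add: count_list_oplus_replicate_uminus)
  qed (fact assms(2))
next
  fix p z x c and \<pi> :: "nat \<Rightarrow> int list"
  assume H: "inj_on \<pi> {0..<k}" "\<pi> ` {0..<k} \<subseteq> pb_seqs q p" "z \<in> {0..<k}"
    "x = flip_prefix z u" "polarity_balanced x" "c = \<pi> z @ x"
  have \<pi>: "\<pi> z \<in> pb_seqs q p" using H(2,3) by blast
  have x: "x \<in> pb_seqs q k"
    using H(4,5) assms(4) by (simp add: pb_seqs_def flip_prefix_mem_seqs)
  show "c \<in> pb_seqs q (p + k)" unfolding H(6) by (rule append_mem_pb_seqs[OF \<pi> x])
  have "length (\<pi> z) = p" using \<pi> by (simp add: pb_seqs_def seqs_def)
  then show "decode_even k p \<pi> c = u" using H by (simp add: decode_even_append)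
next
  fix p a z x c and \<pi> :: "int \<times> nat \<Rightarrow> int list"
  assume q: "odd q"
    and H: "inj_on \<pi> (alphabet q \<times> {0..<k})" "\<pi> ` (alphabet q \<times> {0..<k}) \<subseteq> pb_seqs q p"
    "a \<in> alphabet q" "z \<in> {0..<k}" "x = flip_prefix z (oplus q u (replicate k (- a)))"
    "polarity_balanced x" "c = \<pi> (a, z) @ x"
  have \<pi>: "\<pi> (a, z) \<in> pb_seqs q p" using H(2-4) by blast
  have x: "x \<in> pb_seqs q k"
    using H(3,5,6) q assms(4)
    by (simp add: pb_seqs_def flip_prefix_mem_seqs oplus_replicate_mem_seqs uminus_mem_alphabet)
  show "c \<in> pb_seqs q (p + k)" unfolding H(7) by (rule append_mem_pb_seqs[OF \<pi> x])
  have "length (\<pi> (a, z)) = p" using \<pi> by (simp add: pb_seqs_def seqs_def)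
  \<comment> \<open>Decoding undoes the encoding in reverse order: the second flip cancels the
    first, then adding \<open>a\<close> cancels the shift.\<close>
  then show "decode_odd q k p \<pi> c = u"
    using H q assms(4) by (simp add: decode_odd_append oplus_replicate_uminus_cancel)
qed

end
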